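(* Let $S^n\subset\mathbb{E}^{n+1}$ be a piecewise flat submanifold and let $\gamma:[0,1]\to S^n$ be a geodesic segment intersecting a single hinge $h$, at an angle $\theta$ to the vector orthogonal to $h$ (in $S^n$). Then the integrated curvature along $\gamma$ is $$a_h^\theta := a_\gamma = \cos\theta\ \epsilon_h + O(\epsilon_h^3)$$ for a small hinge angle $\epsilon_h$, with the higher order terms vanishing for $\theta\in\{0,\pm\pi/2\}$.
   Context: $\mathbb{E}^k$ is Euclidean $k$-space. A piecewise flat manifold $S^n$ is a manifold that is a homogeneous simplicial $n$-complex formed from Euclidean $n$-simplices glued along their $(n-1)$-faces with consistent metrics; it is a piecewise flat submanifold of $\mathbb{E}^{n+1}$ if it is embedded piecewise-linearly so that each simplex is flat. A hinge $h$ is an $(n-1)$-simplex of $S^n$; it separates two $n$-simplices. With a given orientation (choice of positive normal $\hat n$), the hinge angle is $\epsilon_h := \pi/2-\phi$, where $\phi$ is the angle between the positive normal to one of the two $n$-simplices and the inward-directed vector tangent to the other $n$-simplex and orthogonal to $h$. It is positive when the pair is concave from the given orientation and negative when convex. A geodesic segment in $S^n$ is a straight segment in each $n$-simplex that continues straight across each hinge when the two adjacent $n$-simplices are unfolded; $\hat\gamma_s$ denotes its unit tangent vector at $\gamma(s)$. The integrated curvature $a_\gamma=\int_\gamma\alpha(\hat\gamma,\hat\gamma)\,\mathrm{d}s$ ($\alpha$ the second fundamental form) is, for such a segment in $S^n$, the signed angle $\psi(\hat\gamma_0,T^\gamma_{1\to0}\hat\gamma_1)$ in $\mathbb{E}^{n+1}$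 between $\hat\gamma_0$ and the parallel transport $T^\gamma_{1\to0}\hat\gamma_1$ of $\hat\gamma_1$ along $\gamma$ back to $\gamma(0)$ (parallel transport in $\mathbb{E}^{n+1}$ is translation), positive if the normal component of $T^\gamma_{1\to0}\hat\gamma_1-\hat\gamma_0$ is in the positive $\hat n$ direction and negative otherwise.
   Formalization: The angle φ defining the hinge angle is taken as a directed angle in the plane normal to h, so almost completely folded hinges do not count as having small hinge angle; and γ must meet h at an interior parameter, not merely touch it with an endpoint. The claim fails in those cases. *)

theory Defs
  imports "HOL-Analysis.Analysis"
begin

section \<open>Piecewise flat submanifolds\<close>

text \<open>
  The library's \<^const>\<open>simplicial_complex\<close> is finite. The version here is only locally
  finite, so that unbounded hypersurfaces are included. As in the library, the empty simplex
  (of dimension -1) belongs to every nonempty complex.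
\<close>

definition loc_simplicial_complex :: "'a::euclidean_space set set \<Rightarrow> bool" where
  "loc_simplicial_complex K \<longleftrightarrow>
     (\<forall>x\<in>\<Union>K. \<exists>U. open U \<and> x \<in> U \<and> finite {T\<in>K. T \<inter> U \<noteq> {}}) \<and>
     (\<forall>T\<in>K. \<exists>k. k simplex T) \<and>
     (\<forall>F T. T \<in> K \<and> F face_of T \<longrightarrow> F \<in> K) \<and>
     (\<forall>T\<in>K. \<forall>T'\<in>K. (T \<inter> T') face_of T)"

text \<open>
  A piecewise-linear embedding that is flat on each simplex is recorded by its image, a geometric
  simplicial complex in the ambient space; the metric of the simplices is the induced one.
\<close>

definition piecewise_flat_submanifold :: "nat \<Rightarrow> (real^'m) set set \<Rightarrow> bool" where
  "piecewise_flat_submanifold n K \<longleftrightarrow>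
     CARD('m) = n + 1 \<and>
     loc_simplicial_complex K \<and>
     (\<forall>T\<in>K. \<exists>T'\<in>K. int n simplex T' \<and> T face_of T') \<and>
     (\<forall>x\<in>\<Union>K. \<exists>U. openin (top_of_set (\<Union>K)) U \<and> x \<in> U \<and>
        top_of_set U homeomorphic_space Euclidean_space n)"

definition hinge :: "nat \<Rightarrow> 'a::euclidean_space set set \<Rightarrow> 'a set \<Rightarrow> 'a set \<Rightarrow> 'a set \<Rightarrow> bool" where
  "hinge n K h P Q \<longleftrightarrow>
     h \<in> K \<and> (int n - 1) simplex h \<and>
     P \<noteq> Q \<and> {T\<in>K. int n simplex T \<and> h \<subseteq> T} = {P, Q}"

section \<open>Angles\<close>

definition vangle :: "'a::euclidean_space \<Rightarrow> 'a \<Rightarrow> real" where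
  "vangle u v = arccos ((u \<bullet> v) / (norm u * norm v))"

text \<open>
  The angle from \<open>a\<close> to \<open>v\<close> in the plane with orthonormal basis \<open>a\<close>, \<open>b\<close>, counted positively
  towards \<open>b\<close>. On the half plane of \<open>b\<close> it is the unoriented angle.
\<close>

definition directed_angle :: "'a::euclidean_space \<Rightarrow> 'a \<Rightarrow> 'a \<Rightarrow> real" where
  "directed_angle a b v =
     (THE \<phi>. - (pi/2) < \<phi> \<and> \<phi> \<le> 3*pi/2 \<and> v = cos \<phi> *\<^sub>R a + sin \<phi> *\<^sub>R b)"

lemma directed_angle_eq_vangle:
  assumes ab: "norm a = 1" "norm b = 1" "a \<bullet> b = 0"
    and v: "v \<in> span {a, b}" "norm v = 1" "0 \<le> v \<bullet> b"
  shows "directed_angle a b v = vangle a v"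
proof -
  obtain x y where xy: "v = x *\<^sub>R a + y *\<^sub>R b"
    using v(1) by (auto simp: span_insert span_singleton algebra_simps)
  have aa: "a \<bullet> a = 1" "b \<bullet> b = 1" "b \<bullet> a = 0"
    using ab by (auto simp: norm_eq_1 inner_commute)
  have y: "0 \<le> y" and ax: "a \<bullet> v = x"
    using v(3) by (simp_all add: xy inner_add_left inner_add_right aa ab(3))
  have "v \<bullet> v = x\<^sup>2 + y\<^sup>2"
    by (simp add: xy inner_add_left inner_add_right aa ab(3) power2_eq_square)
  then have sq: "x\<^sup>2 + y\<^sup>2 = 1" using v(2) by (simp add: norm_eq_1)
  then have "x\<^sup>2 \<le> 1" using zero_le_power2[of y] by linarith
  then have x: "-1 \<le> x" "x \<le> 1" by (auto simp: abs_square_le_1 abs_le_iff)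
  define \<phi> where "\<phi> = arccos x"
  have vang: "vangle a v = \<phi>" by (simp add: vangle_def ab v ax \<phi>_def)
  have c: "cos \<phi> = x" using x by (simp add: \<phi>_def)
  have s: "sin \<phi> = y"
    using x y sq by (simp add: \<phi>_def sin_arccos real_sqrt_unique)
  have r: "0 \<le> \<phi>" "\<phi> \<le> pi"
    using x by (simp_all add: \<phi>_def arccos_lbound arccos_ubound)
  show ?thesis
    unfolding directed_angle_def vang
  proof (rule the_equality)
    show "- (pi/2) < \<phi> \<and> \<phi> \<le> 3*pi/2 \<and> v = cos \<phi> *\<^sub>R a + sin \<phi> *\<^sub>R b"
    proof (intro conjI)
      show "- (pi/2) < \<phi>" "\<phi> \<le> 3*pi/2" using r pi_gt_zero by linarith+
      show "v = cos \<phi> *\<^sub>R a + sin \<phi> *\<^sub>R b" by (simp add: c s xy)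
    qed
  next
    fix t assume t: "- (pi/2) < t \<and> t \<le> 3*pi/2 \<and> v = cos t *\<^sub>R a + sin t *\<^sub>R b"
    then have vt: "v = cos t *\<^sub>R a + sin t *\<^sub>R b" by blast
    have "a \<bullet> v = cos t" "b \<bullet> v = sin t"
      unfolding vt by (simp_all add: inner_add_right aa ab(3))
    moreover have "b \<bullet> v = y" by (simp add: xy inner_add_right aa)
    ultimately have "cos t = x" "sin t = y" using ax by simp_all
    then have "cos t = cos \<phi>" "sin t = sin \<phi>" using c s by simp_all
    then obtain k :: int where k: "t = \<phi> + 2 * pi * k"
      using sin_cos_eq_iff[of t \<phi>] by auto
    have "k = 0"
    proof (rule ccontr)
      assume "k \<noteq> 0"
      then consider "k \<ge> 1" | "k \<le> -1" by linarith
      then show False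
      proof cases
        case 1
        then have "pi * 1 \<le> pi * real_of_int k" by (intro mult_left_mono) auto
        moreover have "t \<le> 3*pi/2" "t = \<phi> + 2 * (pi * real_of_int k)" using k t by simp_all
        ultimately show False using r pi_gt_zero by linarith
      next
        case 2
        then have "pi * real_of_int k \<le> pi * (-1)" by (intro mult_left_mono) auto
        moreover have "- (pi/2) < t" "t = \<phi> + 2 * (pi * real_of_int k)" using k t by simp_all
        ultimately show False using r pi_gt_zero by linarith
      qed
    qed
    then show "t = \<phi>" using k by simp
  qed
qed

section \<open>Hinges\<close>

definition directions :: "'a::euclidean_space set \<Rightarrow> 'a set" where
  "directions T = {x - y | x y. x \<in> affine hull T \<and> y \<in> affine hull T}"

text \<open>The inward-directed unit vector tangent to \<open>T\<close> and orthogonal to its facet \<open>h\<close>.\<close>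

definition conormal :: "'a::euclidean_space set \<Rightarrow> 'a set \<Rightarrow> 'a" where
  "conormal h T =
     (THE v. norm v = 1 \<and> v \<in> directions T \<and> (\<forall>d\<in>directions h. v \<bullet> d = 0) \<and>
             (\<forall>x\<in>T. \<forall>y\<in>h. 0 \<le> v \<bullet> (x - y)))"

text \<open>
  The linear part of the rotation about \<open>h\<close> that unfolds \<open>Q\<close> into the hyperplane of \<open>P\<close>, on the
  side of \<open>h\<close> opposite to \<open>P\<close>.
\<close>

definition unfolding_rotation :: "(real^'m) set \<Rightarrow> (real^'m) set \<Rightarrow> (real^'m) set \<Rightarrow> real^'m^'m \<Rightarrow> bool"
  where "unfolding_rotation h P Q U \<longleftrightarrow>
     rotation_matrix U \<and>
     (\<forall>d\<in>directions h. U *v d = d) \<and>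
     U *v conormal h Q = - conormal h P"

definition unit_normal :: "'a::euclidean_space set \<Rightarrow> 'a \<Rightarrow> bool" where
  "unit_normal T v \<longleftrightarrow> norm v = 1 \<and> (\<forall>d\<in>directions T. v \<bullet> d = 0)"

text \<open>
  \<open>N\<close> gives the positive normals. They are only required to exist and to agree on the pair of
  simplices at the hinge, so a nonorientable hypersurface is not excluded; an orientation of the
  whole hypersurface restricts to such an \<open>N\<close> at every hinge.
\<close>

definition positive_normals ::
  "(real^'m) set \<Rightarrow> (real^'m) set \<Rightarrow> (real^'m) set \<Rightarrow> ((real^'m) set \<Rightarrow> real^'m) \<Rightarrow> bool" where
  "positive_normals h P Q N \<longleftrightarrow>
     unit_normal P (N P) \<and> unit_normal Q (N Q) \<and>
     (\<exists>U. unfolding_rotation h P Q U \<and> U *v N Q = N P)"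

text \<open>
  The angle \<open>\<phi>\<close> between the positive normal of \<open>P\<close> and the inward conormal of \<open>Q\<close> is the directed
  one: it is \<open>pi/2\<close> for a flat hinge, decreases to \<open>-pi/2\<close> as \<open>Q\<close> is folded onto \<open>P\<close> on the
  positive side and increases to \<open>3*pi/2\<close> on the negative side. By
  \<open>directed_angle_eq_vangle\<close> it is the unoriented angle unless the dihedral angle at \<open>h\<close> is acute;
  with the unoriented angle an almost completely folded hinge would have a hinge angle near 0.
\<close>

definition hinge_angle :: "'a::euclidean_space set \<Rightarrow> 'a set \<Rightarrow> 'a set \<Rightarrow> ('a set \<Rightarrow> 'a) \<Rightarrow> real" where
  "hinge_angle h P Q N = pi/2 - directed_angle (N P) (- conormal h P) (conormal h Q)"

section \<open>Geodesic segments\<close>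

text \<open>
  The segment runs through the \<open>n\<close>-simplices \<open>T 0, \<dots>, T m\<close>, with constant velocity \<open>w i\<close> in
  \<open>T i\<close>. It is parametrised on the unit interval proportionally to arc length: unfolding
  preserves the length of the velocity.
\<close>

definition geodesic_segment :: "nat \<Rightarrow> (real^'m) set set \<Rightarrow> (real \<Rightarrow> real^'m) \<Rightarrow> bool" where
  "geodesic_segment n K \<gamma> \<longleftrightarrow>
     (\<exists>(m::nat) t T w.
        t 0 = 0 \<and> t (Suc m) = 1 \<and> (\<forall>i\<le>m. t i < t (Suc i)) \<and>
        (\<forall>i\<le>m. T i \<in> K \<and> int n simplex T i \<and> w i \<noteq> 0 \<and>
           (\<forall>s\<in>{t i..t (Suc i)}. \<gamma> s \<in> T i \<and> \<gamma> s = \<gamma> (t i) + (s - t i) *\<^sub>R w i)) \<and>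
        (\<forall>i<m. (int n - 1) simplex (T i \<inter> T (Suc i)) \<and>
           (\<exists>U. unfolding_rotation (T i \<inter> T (Suc i)) (T i) (T (Suc i)) U \<and>
                U *v w (Suc i) = w i)))"

text \<open>
  The segment passes through \<open>h\<close> at an interior time, not just with an end point, and meets no
  other \<open>(n-1)\<close>-simplex.
\<close>

definition crosses_only_hinge ::
  "nat \<Rightarrow> 'a::euclidean_space set set \<Rightarrow> (real \<Rightarrow> 'a) \<Rightarrow> 'a set \<Rightarrow> bool" where
  "crosses_only_hinge n K \<gamma> h \<longleftrightarrow>
     (\<exists>s\<in>{0<..<1}. \<gamma> s \<in> h) \<and>
     (\<forall>h'\<in>K. (int n - 1) simplex h' \<and> \<gamma> ` {0..1} \<inter> h' \<noteq> {} \<longrightarrow> h' = h)"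

definition unit_tangent :: "(real \<Rightarrow> 'a::euclidean_space) \<Rightarrow> real \<Rightarrow> 'a" where
  "unit_tangent \<gamma> s = sgn (vector_derivative \<gamma> (at s within {0..1}))"

text \<open>
  The signed angle in the ambient space between the initial tangent and the final tangent
  transported back to the initial point, for the positive normal \<open>\<nu>\<close> at the initial point.
  Parallel transport in the ambient space is translation, the identity on vectors.
\<close>

definition integrated_curvature :: "'a::euclidean_space \<Rightarrow> (real \<Rightarrow> 'a) \<Rightarrow> real" where
  "integrated_curvature \<nu> \<gamma> =
     (let u = unit_tangent \<gamma> 0; v = unit_tangent \<gamma> 1
      in if 0 < (v - u) \<bullet> \<nu> then vangle u v else - vangle u v)"

end

theory Submission
  imports Defs
begin

text \<open>
  Let \<open>\<epsilon>\<close> be the hinge angle and \<open>a\<close>, \<open>b\<close> the inward conormals of the two simplices. The tangents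
  before and after the hinge are \<open>d - l a\<close> and \<open>d + l b\<close>, where \<open>d\<close> is parallel to the hinge and
  \<open>l = cos \<theta> \<ge> 0\<close>. Since \<open>a \<bullet> b = - cos \<epsilon>\<close>, the angle between them satisfies
  \<open>cos \<psi> = 1 - l\<^sup>2 (1 - cos \<epsilon>) = 1 - 2 (l sin (\<epsilon>/2))\<^sup>2\<close>, so that the integrated curvature is exactly
  \<open>2 arcsin (cos \<theta> sin (\<epsilon>/2))\<close>.
\<close>

subsection \<open>Directions and conormals\<close>

lemma directions_eq_span:
  assumes "y \<in> affine hull S"
  shows "directions S = span ((\<lambda>x. - y + x) ` S)"
proof -
  let ?V = "span ((\<lambda>x. - y + x) ` S)"
  have S: "affine hull S = (\<lambda>x. y + x) ` ?V"
    by (rule affine_hull_span_gen[OF assms])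
  show ?thesis
    unfolding directions_def S
  proof (intro equalityI subsetI)
    fix z assume "z \<in> ?V"
    then show "z \<in> {x - x' |x x'. x \<in> (+) y ` ?V \<and> x' \<in> (+) y ` ?V}"
      by (intro CollectI exI[of _ "y + z"] exI[of _ "y + 0"]) (auto intro: span_zero)
  qed (auto intro: span_diff)
qed

lemma subspace_directions:
  assumes "S \<noteq> {}"
  shows "subspace (directions S)"
proof -
  obtain y where "y \<in> S" using assms by blast
  then show ?thesis by (simp add: directions_eq_span[OF hull_inc] subspace_span)
qed

lemma diff_in_directions: "x \<in> S \<Longrightarrow> y \<in> S \<Longrightarrow> x - y \<in> directions S"
  by (auto simp: directions_def intro: hull_inc)

lemma directions_mono: "S \<subseteq> T \<Longrightarrow> directions S \<subseteq> directions T"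
  unfolding directions_def using hull_mono[of S T affine] by blast

lemma directions_convex_hull: "directions (convex hull S) = directions S"
  by (simp add: directions_def affine_hull_convex_hull)

lemma dim_directions:
  assumes "S \<noteq> {}"
  shows "int (dim (directions S)) = aff_dim S"
proof -
  obtain y where "y \<in> S" using assms by blast
  then have y: "y \<in> affine hull S" by (rule hull_inc)
  show ?thesis by (simp add: directions_eq_span[OF y] aff_dim_eq_dim[OF y])
qed

text \<open>A face of a simplex is spanned by some of its vertices. One dimension less leaves out
  exactly one vertex, and affine independence keeps this apex off the affine hull of the
  others.\<close>

lemma simplex_facet_apex:
  fixes T h :: "'a::euclidean_space set"
  assumes T: "k simplex T" and h: "(k - 1) simplex h" "h face_of T"
  obtains a C where "a \<notin> affine hull C" "T = convex hull (insert a C)" "h = convex hull C"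
proof -
  obtain B where B: "\<not> affine_dependent B" "int (card B) = k + 1" "T = convex hull B"
    using T by (auto simp: simplex_def)
  obtain C where C: "C \<subseteq> B" "h = convex hull C"
    using h(2) B face_of_convex_hull_affine_independent by blast
  have fin: "finite B" using B(1) by (rule aff_independent_finite)
  have indep: "\<not> affine_dependent C" using B(1) C(1) affine_dependent_subset by blast
  have "int (card C) = k"
    using aff_dim_simplex[OF h(1)] aff_dim_affine_independent[OF indep]
    by (simp add: C(2) aff_dim_convex_hull)
  then have "card (B - C) = 1"
    using B(2) C(1) fin by (simp add: card_Diff_subset finite_subset)
  then obtain a where a: "B - C = {a}" by (auto simp: card_1_singleton_iff)
  then have "B = insert a C" "a \<notin> C" using C(1) by auto
  moreover from this B(1) have "a \<notin> affine hull C"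
    unfolding affine_dependent_def by auto
  ultimately show thesis using that B(3) C(2) by blast
qed

text \<open>\<open>conormal\<close> is a definite description, so its defining properties become
  available only after existence and uniqueness are shown. The witness is the normalised component
  \<open>z\<close>, orthogonal to the facet, of an edge \<open>e\<close> from the facet to the apex.
  As \<open>e\<close> and the directions of \<open>h\<close> span those of \<open>T\<close>, this
  also yields the decomposition at the end.\<close>

lemma conormal_facet:
  fixes T h :: "'a::euclidean_space set"
  assumes T: "k simplex T" and h: "(k - 1) simplex h" "h face_of T" "h \<noteq> {}"
  shows norm_conormal: "norm (conormal h T) = 1"
    and conormal_in_directions: "conormal h T \<in> directions T"
    and conormal_orthogonal: "\<And>d. d \<in> directions h \<Longrightarrow> conormal h T \<bullet> d = 0"
    and conormal_inward: "\<And>x y. x \<in> T \<Longrightarrow> y \<in> h \<Longrightarrow> 0 \<le> conormal h T \<bullet> (x - y)"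
    and directions_decomp:
      "\<And>x. x \<in> directions T \<Longrightarrow> x - (x \<bullet> conormal h T) *\<^sub>R conormal h T \<in> directions h"
proof -
  obtain a C where a: "a \<notin> affine hull C" and TC: "T = convex hull (insert a C)"
    and hC: "h = convex hull C"
    using simplex_facet_apex[OF T h(1,2)] by blast
  obtain y where y: "y \<in> C" using h(3) hC by fastforce
  have yC: "y \<in> affine hull C" and yh: "y \<in> h" and aT: "a \<in> T"
    using y by (auto simp: hC TC intro: hull_inc)
  define D where "D = directions h"
  define e where "e = - y + a"
  have D: "D = span ((\<lambda>x. - y + x) ` C)"
    by (simp add: D_def hC directions_convex_hull directions_eq_span[OF yC])
  have sD: "subspace D" by (simp add: D subspace_span)
  have "y \<in> affine hull (insert a C)" using y by (auto intro: hull_inc)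
  then have DT: "directions T = span (insert e D)"
    by (simp add: TC directions_convex_hull directions_eq_span e_def D span_insert span_span)
  have "e \<notin> D"
  proof
    assume "e \<in> D"
    then have "y + e \<in> affine hull C"
      unfolding D affine_hull_span_gen[OF yC] by blast
    then show False using a by (simp add: e_def)
  qed
  obtain d0 z where "d0 \<in> span D" and z: "\<And>w. w \<in> span D \<Longrightarrow> orthogonal z w" and e: "e = d0 + z"
    using orthogonal_subspace_decomp_exists[of D e] by blast
  have spD: "span D = D" using sD by (simp add: span_eq_iff)
  then have d0: "d0 \<in> D" and zD: "\<And>w. w \<in> D \<Longrightarrow> z \<bullet> w = 0"
    using \<open>d0 \<in> span D\<close> z unfolding spD orthogonal_def by blast+
  have z0: "z \<noteq> 0" using \<open>e \<notin> D\<close> e d0 by auto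
  define c where "c = z /\<^sub>R norm z"
  have cn: "norm c = 1" by (simp add: c_def z0)
  then have cc: "c \<bullet> c = 1" by (simp add: norm_eq_1)
  have zc: "z = norm z *\<^sub>R c" by (simp add: c_def z0)
  have cD: "c \<bullet> w = 0" if "w \<in> D" for w by (simp add: c_def zD that)
  have "z = e - d0" using e by simp
  then have "z \<in> directions T"
    unfolding DT by (auto intro: span_diff span_base d0)
  then have cT: "c \<in> directions T" unfolding c_def DT by (rule span_scale)
  have ce: "c \<bullet> e = norm z"
    by (subst e, subst zc) (simp add: inner_add_right cD[OF d0] cc)
  have decomp: "x - (x \<bullet> c) *\<^sub>R c \<in> D" if x: "x \<in> directions T" for x
  proof -
    obtain k where "x - k *\<^sub>R e \<in> D" using x by (auto simp: DT span_insert spD)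
    moreover define d where "d = x - k *\<^sub>R e"
    ultimately have d: "d \<in> D" and x': "x = k *\<^sub>R e + d" by auto
    have "c \<bullet> x = k * norm z" by (simp add: x' inner_add_right ce cD[OF d])
    then have "x \<bullet> c = k * norm z" by (simp add: inner_commute)
    then have "x - (x \<bullet> c) *\<^sub>R c = k *\<^sub>R (d0 + z) + d - k *\<^sub>R z"
      by (subst zc) (simp add: x' e)
    also have "\<dots> = k *\<^sub>R d0 + d" by (simp add: scaleR_add_right)
    finally show ?thesis using d d0 sD by (simp add: subspace_add subspace_scale)
  qed
  \<comment> \<open>In a convex combination of the apex and a point of the facet, only the apex part
    contributes along \<open>c\<close>.\<close>
  have inward: "0 \<le> c \<bullet> (x - y')" if x: "x \<in> T" and y': "y' \<in> h" for x y'
  proof -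
    obtain u v b where u: "u \<ge> 0" "u + v = 1" and b: "b \<in> h" and x': "x = u *\<^sub>R a + v *\<^sub>R b"
      using x y unfolding TC by (subst (asm) convex_hull_insert) (auto simp: hC)
    have "v = 1 - u" using u(2) by simp
    then have xy: "x - y' = u *\<^sub>R e + u *\<^sub>R (y - b) + (b - y')"
      unfolding x' e_def by (simp add: scaleR_diff_left scaleR_diff_right scaleR_add_right)
    moreover have "c \<bullet> (y - b) = 0" "c \<bullet> (b - y') = 0"
      using b y' yh by (auto intro!: cD simp: D_def diff_in_directions)
    ultimately show ?thesis unfolding xy using u(1) by (simp add: inner_add_right ce del: add_diff_eq)
  qed
  have "conormal h T = c"
    unfolding conormal_def
  proof (rule the_equality)
    \<comment> \<open>Uniqueness: the part of \<open>v\<close> parallel to the facet is orthogonal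
      to itself, so \<open>v\<close> is a multiple of \<open>c\<close> of modulus 1, and the edge
      \<open>e\<close> decides the sign.\<close>
    fix v assume v: "norm v = 1 \<and> v \<in> directions T \<and> (\<forall>d\<in>directions h. v \<bullet> d = 0) \<and>
      (\<forall>x\<in>T. \<forall>y\<in>h. 0 \<le> v \<bullet> (x - y))"
    define d where "d = v - (v \<bullet> c) *\<^sub>R c"
    have "d \<in> D" unfolding d_def using v by (intro decomp) auto
    then have "v \<bullet> d = 0" "c \<bullet> d = 0" using v cD by (auto simp: D_def)
    then have "d \<bullet> d = 0" by (simp add: d_def inner_diff_left)
    then have vc: "v = (v \<bullet> c) *\<^sub>R c" by (simp add: d_def)
    have "norm v = \<bar>v \<bullet> c\<bar>" by (subst vc) (simp add: cn)
    then have "\<bar>v \<bullet> c\<bar> = 1" using v by simp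
    moreover have "0 \<le> v \<bullet> e"
      using v aT yh by (force simp: e_def)
    moreover have "v \<bullet> e = (v \<bullet> c) * norm z" by (subst vc) (simp add: ce)
    ultimately have "v \<bullet> c = 1" using z0 by (auto simp: abs_if zero_le_mult_iff split: if_splits)
    then show "v = c" using vc by simp
  qed (use cn cT cD inward in \<open>auto simp: D_def\<close>)
  then show "norm (conormal h T) = 1" "conormal h T \<in> directions T"
    "\<And>d. d \<in> directions h \<Longrightarrow> conormal h T \<bullet> d = 0"
    "\<And>x y. x \<in> T \<Longrightarrow> y \<in> h \<Longrightarrow> 0 \<le> conormal h T \<bullet> (x - y)"
    "\<And>x. x \<in> directions T \<Longrightarrow> x - (x \<bullet> conormal h T) *\<^sub>R conormal h T \<in> directions h"
    using cn cT cD inward decomp by (auto simp: D_def)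
qed

subsection \<open>The normal plane of a hinge\<close>

text \<open>In codimension one the directions of \<open>T\<close> fill the hyperplane orthogonal to
  \<open>v\<close>: one subspace contains the other and both have dimension
  \<open>n\<close>.\<close>

lemma orthogonal_unit_normal_in_directions:
  fixes T :: "'a::euclidean_space set"
  assumes T: "int n simplex T" and dim: "DIM('a) = n + 1"
    and v: "unit_normal T v" and x: "x \<bullet> v = 0"
  shows "x \<in> directions T"
proof -
  have ne: "T \<noteq> {}" using T by auto
  have "v \<noteq> 0" using v by (auto simp: unit_normal_def)
  have "directions T = {x. v \<bullet> x = 0}"
  proof (rule subspace_dim_equal)
    show "directions T \<subseteq> {x. v \<bullet> x = 0}" using v by (auto simp: unit_normal_def)
    show "dim {x. v \<bullet> x = 0} \<le> dim (directions T)"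
      using dim_directions[OF ne] aff_dim_simplex[OF T] \<open>v \<noteq> 0\<close> dim
      by (simp add: dim_hyperplane)
  qed (use subspace_directions[OF ne] subspace_hyperplane in auto)
  then show ?thesis using x by (simp add: inner_commute)
qed

text \<open>Conjugation by an orthogonal matrix taking a coordinate axis to \<open>r\<close> makes
  \<open>U\<close> diagonal with a single entry -1. This later excludes a reflection in the role of
  an unfolding rotation.\<close>

lemma det_reflection:
  fixes U :: "real^'m^'m" and r :: "real^'m"
  assumes U: "\<And>x. U *v x = x - (2 * (x \<bullet> r)) *\<^sub>R r" and r: "norm r = 1"
  shows "det U = -1"
proof -
  obtain k :: 'm where True by blast
  obtain B where B: "orthogonal_matrix B" "B *v axis k 1 = r"
    using orthogonal_matrix_exists_basis[OF r] by blast
  let ?e = "axis k 1 :: real^'m"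
  have BB: "transpose B ** B = mat 1" "B ** transpose B = mat 1"
    using B(1) by (auto simp: orthogonal_matrix_def)
  have tBr: "transpose B *v r = ?e"
    unfolding B(2)[symmetric] by (simp add: matrix_vector_mul_assoc BB)
  define M where "M = transpose B ** U ** B"
  have M: "M *v x = x - (2 * (x \<bullet> ?e)) *\<^sub>R ?e" for x
  proof -
    have "(B *v x) \<bullet> r = x \<bullet> ?e"
      by (simp add: dot_lmul_matrix[symmetric] tBr[symmetric] inner_commute)
    then have "U *v (B *v x) = B *v x - (2 * (x \<bullet> ?e)) *\<^sub>R r" by (simp add: U)
    then have "M *v x = transpose B *v (B *v x - (2 * (x \<bullet> ?e)) *\<^sub>R r)"
      by (simp add: M_def matrix_vector_mul_assoc[symmetric])
    also have "\<dots> = x - (2 * (x \<bullet> ?e)) *\<^sub>R ?e"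
      by (simp add: matrix_vector_mult_diff_distrib matrix_vector_mult_scaleR
          matrix_vector_mul_assoc BB tBr[simplified])
    finally show ?thesis .
  qed
  have Mij: "M $ i $ j = (if i = j then if i = k then -1 else 1 else 0)" for i j
  proof -
    have "M $ i $ j = (M *v axis j 1) $ i"
      by (simp add: matrix_vector_mul_component inner_axis)
    also have "\<dots> = (if i = j then if i = k then -1 else 1 else 0)"
      by (simp only: M inner_axis_axis) (auto simp: axis_def)
    finally show ?thesis .
  qed
  have "det M = (\<Prod>i\<in>UNIV. if i = k then -1 else 1)"
    by (subst det_diagonal) (auto simp: Mij)
  also have "\<dots> = -1" by simp
  finally have "det M = -1" .
  moreover have "det B * det B = 1"
    using arg_cong[OF BB(1), of det] by (simp add: det_mul)
  moreover have "det M = (det B * det B) * det U" by (simp add: M_def det_mul)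
  ultimately show ?thesis by simp
qed

text \<open>The range in \<open>directed_angle\<close> is half-open of length 2 pi, so each unit
  vector of the plane has exactly one angle in it and the definite description is
  meaningful.\<close>

lemma directed_angle_spec:
  assumes "norm a = 1" "norm b = 1" "a \<bullet> b = 0" and v: "v = x *\<^sub>R a + y *\<^sub>R b" "norm v = 1"
  shows "v = cos (directed_angle a b v) *\<^sub>R a + sin (directed_angle a b v) *\<^sub>R b"
proof -
  have ab: "a \<bullet> a = 1" "b \<bullet> b = 1" "b \<bullet> a = 0"
    using assms by (auto simp: norm_eq_1 inner_commute)
  have "v \<bullet> v = x\<^sup>2 + y\<^sup>2"
    by (simp add: v(1) inner_add_left inner_add_right ab assms(3) power2_eq_square)
  then have "x\<^sup>2 + y\<^sup>2 = 1" using v(2) by (simp add: norm_eq_1)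
  then obtain s where s: "0 \<le> s" "s < 2 * pi" "x = cos s" "y = sin s"
    by (rule sincos_total_2pi)
  \<comment> \<open>Angles in [0, 2 pi) beyond 3 pi / 2 are moved down by a full turn to reach the
    range of \<open>directed_angle\<close>.\<close>
  define t where "t = (if s \<le> 3*pi/2 then s else s - 2 * pi)"
  have t: "- (pi/2) < t \<and> t \<le> 3*pi/2 \<and> v = cos t *\<^sub>R a + sin t *\<^sub>R b"
    using s pi_gt_zero by (auto simp: t_def v(1) cos_diff sin_diff)
  have "\<exists>!t. - (pi/2) < t \<and> t \<le> 3*pi/2 \<and> v = cos t *\<^sub>R a + sin t *\<^sub>R b"
  proof (rule ex1I, rule t)
    fix t' assume t': "- (pi/2) < t' \<and> t' \<le> 3*pi/2 \<and> v = cos t' *\<^sub>R a + sin t' *\<^sub>R b"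
    have "cos q = v \<bullet> a \<and> sin q = v \<bullet> b" if "v = cos q *\<^sub>R a + sin q *\<^sub>R b" for q
      by (simp add: that inner_add_left ab assms(3))
    then have "cos t' = cos t" "sin t' = sin t" using t t' by metis+
    then obtain k :: int where k: "t' = t + 2 * pi * k"
      using sin_cos_eq_iff[of t' t] by auto
    have "\<bar>2 * pi * k\<bar> < 2 * pi" using k t t' by linarith
    then have "\<bar>real_of_int k\<bar> < 1" by (simp add: abs_mult)
    then have "k = 0" by linarith
    then show "t' = t" using k by simp
  qed
  from theI'[OF this] show ?thesis unfolding directed_angle_def by blast
qed

text \<open>Normals and conormals of both simplices lie in the plane orthogonal to \<open>h\<close>.
  There the hinge angle fixes the conormal of \<open>Q\<close>, orthogonality fixes
  \<open>N Q\<close> up to sign, and the sign comes from the unfolding being a rotation.\<close>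

lemma hinge_frame:
  fixes P Q h :: "(real^'m) set" and N
  defines "\<epsilon> \<equiv> hinge_angle h P Q N"
  assumes card: "CARD('m) = n + 1"
    and P: "int n simplex P" and Q: "int n simplex Q"
    and h: "(int n - 1) simplex h" "h face_of P" "h face_of Q" "h \<noteq> {}"
    and N: "positive_normals h P Q N"
  shows "conormal h Q = sin \<epsilon> *\<^sub>R N P - cos \<epsilon> *\<^sub>R conormal h P"
    and "N Q = cos \<epsilon> *\<^sub>R N P + sin \<epsilon> *\<^sub>R conormal h P"
proof -
  define b c q where "b = N P" and "c = conormal h P" and "q = conormal h Q"
  note cP = conormal_facet[OF P h(1,2,4), folded c_def]
  note cQ = conormal_facet[OF Q h(1,3,4), folded q_def]
  obtain U where U: "rotation_matrix U" "\<And>d. d \<in> directions h \<Longrightarrow> U *v d = d"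
      "U *v q = - c" "U *v N Q = b"
    and uP: "unit_normal P b" and uQ: "unit_normal Q (N Q)"
    using N by (auto simp: positive_normals_def unfolding_rotation_def b_def c_def q_def)
  have hP: "directions h \<subseteq> directions P" and hQ: "directions h \<subseteq> directions Q"
    using h by (auto intro!: directions_mono dest: face_of_imp_subset)
  have bn: "norm b = 1" and Qn: "norm (N Q) = 1" using uP uQ by (auto simp: unit_normal_def)
  have bc: "b \<bullet> c = 0" using uP cP(2) by (auto simp: unit_normal_def)
  have qN: "N Q \<bullet> q = 0" using uQ cQ(2) by (auto simp: unit_normal_def)
  have bD: "b \<bullet> d = 0" and QD: "N Q \<bullet> d = 0" if "d \<in> directions h" for d
    using uP uQ hP hQ that by (auto simp: unit_normal_def)
  have ip: "b \<bullet> b = 1" "c \<bullet> c = 1" "b \<bullet> c = 0" "c \<bullet> b = 0"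
    using bn cP(1) bc by (auto simp: norm_eq_1 inner_commute)
  \<comment> \<open>Removing the component along \<open>b\<close> leaves a direction of
    \<open>P\<close>; removing the one along \<open>c\<close> then leaves a direction of
    \<open>h\<close>.\<close>
  have decomp: "x - (x \<bullet> b) *\<^sub>R b - (x \<bullet> c) *\<^sub>R c \<in> directions h" for x
  proof -
    have "x - (x \<bullet> b) *\<^sub>R b \<in> directions P"
      by (rule orthogonal_unit_normal_in_directions[OF P _ uP])
        (simp_all add: card inner_diff_left ip)
    from cP(5)[OF this] show ?thesis by (simp add: inner_diff_left ip)
  qed
  have plane: "x = (x \<bullet> b) *\<^sub>R b + (x \<bullet> c) *\<^sub>R c" if x: "\<And>d. d \<in> directions h \<Longrightarrow> x \<bullet> d = 0" for x
  proof -
    define d where "d = x - (x \<bullet> b) *\<^sub>R b - (x \<bullet> c) *\<^sub>R c"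
    have d: "d \<in> directions h" using decomp d_def by simp
    have "d \<bullet> d = x \<bullet> d - (x \<bullet> b) * (b \<bullet> d) - (x \<bullet> c) * (c \<bullet> d)"
      by (subst (1) d_def) (simp add: inner_diff_left)
    then have "d = 0" using x[OF d] bD[OF d] cP(3)[OF d] by simp
    then show ?thesis by (simp add: d_def algebra_simps)
  qed
  have "q = cos (directed_angle b (- c) q) *\<^sub>R b + sin (directed_angle b (- c) q) *\<^sub>R - c"
    by (rule directed_angle_spec[of b "- c" q "q \<bullet> b" "- (q \<bullet> c)"])
      (use bn cP(1) bc cQ(1) plane[OF cQ(3)] in simp_all)
  \<comment> \<open>The shift by pi/2 in \<open>hinge_angle\<close> exchanges sine and cosine in the
    coordinates of \<open>q\<close>.\<close>
  moreover have \<epsilon>: "directed_angle b (- c) q = pi/2 - \<epsilon>"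
    by (simp add: \<epsilon>_def hinge_angle_def b_def c_def q_def)
  ultimately have q: "q = sin \<epsilon> *\<^sub>R b - cos \<epsilon> *\<^sub>R c"
    by (simp add: cos_diff sin_diff)
  define x y where "x = N Q \<bullet> b" and "y = N Q \<bullet> c"
  have NQ: "N Q = x *\<^sub>R b + y *\<^sub>R c" using plane[OF QD] by (simp add: x_def y_def)
  have "N Q \<bullet> N Q = x\<^sup>2 + y\<^sup>2"
    by (simp add: NQ inner_add_left inner_add_right ip power2_eq_square)
  then have xy1: "x\<^sup>2 + y\<^sup>2 = 1" using Qn by (simp add: norm_eq_1)
  have xy0: "x * sin \<epsilon> = y * cos \<epsilon>"
    using qN by (simp add: NQ q inner_add_left inner_diff_right ip mult.commute)
  \<comment> \<open>Since \<open>N Q\<close> is orthogonal to \<open>q\<close>, its coordinates are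
    \<open>s\<close> times the unit vector (cos \<epsilon>, sin \<epsilon>), and unit length leaves
    only \<open>s\<close> = 1 or -1.\<close>
  define s where "s = x * cos \<epsilon> + y * sin \<epsilon>"
  have sc: "sin \<epsilon> * sin \<epsilon> + cos \<epsilon> * cos \<epsilon> = 1"
    using sin_cos_squared_add[of \<epsilon>] by (simp add: power2_eq_square)
  have x: "x = s * cos \<epsilon>" and y: "y = s * sin \<epsilon>"
    unfolding s_def using sc xy0 by algebra+
  have "s\<^sup>2 = 1" using xy1 sc unfolding x y by algebra
  then consider "s = 1" | "s = -1" by (auto simp: power2_eq_1_iff)
  \<comment> \<open>The sign is where \<open>det U = 1\<close> enters: for \<open>s = -1\<close> the map \<open>U\<close> would be a reflection.\<close>
  then have "s = 1"
  proof cases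
    case 2
    then have NQ': "N Q = - (cos \<epsilon> *\<^sub>R b) - sin \<epsilon> *\<^sub>R c" by (simp add: NQ x y)
    \<comment> \<open>In this plane \<open>U\<close> is given on \<open>q\<close> and
      \<open>N Q\<close>, so \<open>b\<close>, and below \<open>c\<close>, are expressed through
      these to find their images.\<close>
    have "sin \<epsilon> *\<^sub>R q - cos \<epsilon> *\<^sub>R N Q = (sin \<epsilon> * sin \<epsilon>) *\<^sub>R b + (cos \<epsilon> * cos \<epsilon>) *\<^sub>R b"
      by (simp add: q NQ' algebra_simps)
    then have "b = sin \<epsilon> *\<^sub>R q - cos \<epsilon> *\<^sub>R N Q" using sc by (simp flip: scaleR_add_left)
    then have "U *v b = U *v (sin \<epsilon> *\<^sub>R q - cos \<epsilon> *\<^sub>R N Q)" by simp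
    then have Ub: "U *v b = - (sin \<epsilon> *\<^sub>R c) - cos \<epsilon> *\<^sub>R b"
      by (simp add: matrix_vector_mult_diff_distrib matrix_vector_mult_scaleR U)
    have "- (sin \<epsilon> *\<^sub>R N Q) - cos \<epsilon> *\<^sub>R q = (sin \<epsilon> * sin \<epsilon>) *\<^sub>R c + (cos \<epsilon> * cos \<epsilon>) *\<^sub>R c"
      by (simp add: q NQ' algebra_simps)
    then have "c = (- sin \<epsilon>) *\<^sub>R N Q - cos \<epsilon> *\<^sub>R q" using sc by (simp flip: scaleR_add_left)
    then have "U *v c = U *v ((- sin \<epsilon>) *\<^sub>R N Q - cos \<epsilon> *\<^sub>R q)" by simp
    then have Uc: "U *v c = - (sin \<epsilon> *\<^sub>R b) + cos \<epsilon> *\<^sub>R c"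
      by (simp add: matrix_vector_mult_diff_distrib matrix_vector_mult_scaleR U
          del: scaleR_minus_left) simp
    \<comment> \<open>\<open>U\<close> sends the unit vector \<open>r\<close>, at angle \<epsilon>/2
      from \<open>b\<close> towards \<open>c\<close>, to \<open>- r\<close> and fixes all vectors
      orthogonal to it. The double-angle formulas turn the matrix entries of \<open>U\<close> into
      this form.\<close>
    define C S where "C = cos (\<epsilon>/2)" and "S = sin (\<epsilon>/2)"
    have CS: "cos \<epsilon> = 2 * C\<^sup>2 - 1" "cos \<epsilon> = 1 - 2 * S\<^sup>2" "sin \<epsilon> = 2 * S * C"
      using cos_double_cos[of "\<epsilon>/2"] cos_double_sin[of "\<epsilon>/2"] sin_double[of "\<epsilon>/2"]
      by (simp_all add: C_def S_def)
    define r where "r = C *\<^sub>R b + S *\<^sub>R c"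
    have "r \<bullet> r = C\<^sup>2 + S\<^sup>2"
      by (simp add: r_def inner_add_left inner_add_right ip power2_eq_square)
    then have "norm r = 1" by (simp add: C_def S_def norm_eq_1)
    moreover have "U *v z = z - (2 * (z \<bullet> r)) *\<^sub>R r" for z
    proof -
      define d \<beta> \<eta> where "d = z - (z \<bullet> b) *\<^sub>R b - (z \<bullet> c) *\<^sub>R c"
        and "\<beta> = z \<bullet> b" and "\<eta> = z \<bullet> c"
      have z: "z = d + \<beta> *\<^sub>R b + \<eta> *\<^sub>R c" by (simp add: d_def \<beta>_def \<eta>_def)
      have d: "d \<in> directions h" unfolding d_def by (rule decomp)
      have zr: "z \<bullet> r = \<beta> * C + \<eta> * S"
        by (simp add: r_def \<beta>_def \<eta>_def inner_add_right)
      have "U *v z = d + \<beta> *\<^sub>R (U *v b) + \<eta> *\<^sub>R (U *v c)"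
        by (simp add: z matrix_vector_right_distrib matrix_vector_mult_scaleR U(2)[OF d])
      also have "\<dots> = d + (- \<beta> * cos \<epsilon> - \<eta> * sin \<epsilon>) *\<^sub>R b + (\<eta> * cos \<epsilon> - \<beta> * sin \<epsilon>) *\<^sub>R c"
        by (simp add: Ub Uc algebra_simps)
      also have "- \<beta> * cos \<epsilon> - \<eta> * sin \<epsilon> = \<beta> - 2 * (\<beta> * C + \<eta> * S) * C"
        by (simp add: CS(1,3) algebra_simps power2_eq_square)
      also have "\<eta> * cos \<epsilon> - \<beta> * sin \<epsilon> = \<eta> - 2 * (\<beta> * C + \<eta> * S) * S"
        by (simp add: CS(2,3) algebra_simps power2_eq_square)
      also have "d + (\<beta> - 2 * (\<beta> * C + \<eta> * S) * C) *\<^sub>R b + (\<eta> - 2 * (\<beta> * C + \<eta> * S) * S) *\<^sub>R c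
        = z - (2 * (z \<bullet> r)) *\<^sub>R r"
        unfolding zr by (simp add: z r_def algebra_simps)
      finally show ?thesis .
    qed
    ultimately have "det U = -1" by (intro det_reflection)
    then show ?thesis using U(1) by (simp add: rotation_matrix_def)
  qed
  then show "conormal h Q = sin \<epsilon> *\<^sub>R N P - cos \<epsilon> *\<^sub>R conormal h P"
    "N Q = cos \<epsilon> *\<^sub>R N P + sin \<epsilon> *\<^sub>R conormal h P"
    using q NQ x y by (simp_all add: b_def c_def q_def)
qed

subsection \<open>Tangents of a geodesic segment across a hinge\<close>

lemma velocity_in_directions:
  assumes "x \<in> S" "x + r *\<^sub>R w \<in> S" "r \<noteq> 0"
  shows "w \<in> directions S"
proof -
  have "(x + r *\<^sub>R w) - x \<in> directions S" using assms by (intro diff_in_directions)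
  then have "inverse r *\<^sub>R r *\<^sub>R w \<in> directions S"
    using subspace_scale[OF subspace_directions] assms(1) by (metis add_diff_cancel_left' empty_iff)
  then show ?thesis using assms(3) by simp
qed

lemma rotation_matrix_inj:
  fixes U :: "real^'m^'m"
  assumes "rotation_matrix U" "U *v x = U *v y"
  shows "x = y"
proof -
  have "transpose U *v (U *v x) = transpose U *v (U *v y)" using assms(2) by simp
  then show ?thesis
    using assms(1)
    by (simp add: matrix_vector_mul_assoc rotation_matrix_def orthogonal_matrix_def
        del: transpose_matrix_vector)
qed

text \<open>At an end of the unit interval the derivative within it is one-sided, so the linear
  piece adjacent to that end determines it.\<close>

lemma unit_tangent_linear:
  fixes \<gamma> :: "real \<Rightarrow> 'a::euclidean_space"
  assumes "a < b" "{a..b} \<subseteq> {0..1}" "s = a \<and> a = 0 \<or> s = b \<and> b = 1"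
    and \<gamma>: "\<And>s. s \<in> {a..b} \<Longrightarrow> \<gamma> s = \<gamma> a + (s - a) *\<^sub>R w"
  shows "unit_tangent \<gamma> s = sgn w"
proof -
  have lin: "((\<lambda>s. \<gamma> a + (s - a) *\<^sub>R w) has_vector_derivative w) (at s within {0..1})"
    by (auto intro!: derivative_eq_intros)
  have s: "s \<in> {0..1}" using assms(1-3) by auto
  have "(\<gamma> has_vector_derivative w) (at s within {0..1})"
    by (rule has_vector_derivative_transform_within[OF lin _ s, where d = "b - a"])
      (use assms(1,3) in \<open>auto simp: dist_real_def intro!: \<gamma>[symmetric]\<close>)
  from vector_derivative_within_closed_interval[OF _ s this] show ?thesis
    by (simp add: unit_tangent_def)
qed

lemma hinge_facets:
  assumes K: "loc_simplicial_complex K" and h: "hinge n K h P Q" and "A \<in> {P, Q}"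
  shows "A \<in> K" "int n simplex A" "h face_of A"
proof -
  have A: "A \<in> {T\<in>K. int n simplex T \<and> h \<subseteq> T}" and "h \<in> K"
    using h assms(3) by (auto simp: hinge_def)
  then show "A \<in> K" "int n simplex A" by auto
  have "(A \<inter> h) face_of A" using K A \<open>h \<in> K\<close> by (auto simp: loc_simplicial_complex_def)
  moreover have "A \<inter> h = h" using A by auto
  ultimately show "h face_of A" by simp
qed

text \<open>The unfolding fixes directions of \<open>h\<close> and takes the conormal of
  \<open>B\<close> to minus that of \<open>A\<close>, so both tangents share the same
  \<open>d\<close> and \<open>l\<close>. Most of the work is to show that a segment not parallel to
  \<open>h\<close> has exactly two pieces, the first in \<open>A\<close>.\<close>

lemma geodesic_tangents:
  fixes K :: "(real^'m) set set"
  assumes n: "n \<ge> 1" and K: "loc_simplicial_complex K" and h: "hinge n K h P Q"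
    and geo: "geodesic_segment n K \<gamma>" and cross: "crosses_only_hinge n K \<gamma> h"
    and A: "A \<in> {P, Q}" "\<gamma> 0 \<in> A"
  obtains B d l where "{A, B} = {P, Q}" "d \<in> directions h" "0 \<le> l"
    "norm (unit_tangent \<gamma> 0) = 1"
    "unit_tangent \<gamma> 0 = d - l *\<^sub>R conormal h A" "unit_tangent \<gamma> 1 = d + l *\<^sub>R conormal h B"
proof -
  have hK: "h \<in> K" and hs: "(int n - 1) simplex h" and PQ: "P \<noteq> Q"
    and adj: "{T\<in>K. int n simplex T \<and> h \<subseteq> T} = {P, Q}"
    using h by (auto simp: hinge_def)
  have hne: "h \<noteq> {}" using hs n by auto
  have sD: "subspace (directions h)" using hne by (rule subspace_directions)
  have cap: "(S \<inter> S') face_of S" if "S \<in> K" "S' \<in> K" for S S'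
    using K that by (auto simp: loc_simplicial_complex_def)
  have face_K: "F \<in> K" if "S \<in> K" "F face_of S" for F S
    using K that by (auto simp: loc_simplicial_complex_def)
  obtain m t T w where t0: "t 0 = 0" and t1: "t (Suc m) = 1"
    and "\<forall>i\<le>m. t i < t (Suc i)"
    and piece: "\<forall>i\<le>m. T i \<in> K \<and> int n simplex T i \<and> w i \<noteq> 0 \<and>
      (\<forall>s\<in>{t i..t (Suc i)}. \<gamma> s \<in> T i \<and> \<gamma> s = \<gamma> (t i) + (s - t i) *\<^sub>R w i)"
    and turn: "\<forall>i<m. (int n - 1) simplex (T i \<inter> T (Suc i)) \<and>
      (\<exists>U. unfolding_rotation (T i \<inter> T (Suc i)) (T i) (T (Suc i)) U \<and> U *v w (Suc i) = w i)"
    using geo unfolding geodesic_segment_def by blast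
  then have t: "\<And>i. i \<le> m \<Longrightarrow> t i < t (Suc i)" by blast
  have T: "T i \<in> K" "int n simplex T i" and w0: "w i \<noteq> 0" if "i \<le> m" for i
    using piece that by blast+
  have \<gamma>T: "\<gamma> s \<in> T i" and \<gamma>: "\<gamma> s = \<gamma> (t i) + (s - t i) *\<^sub>R w i"
    if "i \<le> m" "s \<in> {t i..t (Suc i)}" for i s
    using piece that by blast+
  have cut: "(int n - 1) simplex (T i \<inter> T (Suc i))"
    and unf: "\<exists>U. unfolding_rotation (T i \<inter> T (Suc i)) (T i) (T (Suc i)) U \<and> U *v w (Suc i) = w i"
    if "i < m" for i
    using turn that by blast+
  have tmono: "j \<le> Suc m \<Longrightarrow> i \<le> j \<Longrightarrow> t i \<le> t j" for i j
  proof (induction j)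
    case (Suc j)
    then show ?case using t[of j] by (cases "i = Suc j") auto
  qed simp
  have t01: "0 \<le> t i" "t i \<le> 1" if "i \<le> Suc m" for i
    using tmono[of i 0] tmono[of "Suc m" i] that t0 t1 by auto
  have \<gamma>step: "\<gamma> (t (Suc i)) = \<gamma> (t i) + (t (Suc i) - t i) *\<^sub>R w i" if "i \<le> m" for i
    by (rule \<gamma>) (use that t[OF that] in auto)
  have \<gamma>end: "\<gamma> (t i) \<in> T i" "\<gamma> (t (Suc i)) \<in> T i" if "i \<le> m" for i
    using \<gamma>T[OF that] t[OF that] by auto
  \<comment> \<open>Consecutive pieces meet in an (n-1)-simplex of the complex that the segment
    hits, and \<open>h\<close> is the only such simplex.\<close>
  have capT: "T i \<inter> T (Suc i) = h" if i: "i < m" for i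
  proof -
    have "T i \<in> K" "T (Suc i) \<in> K" using T(1)[of i] T(1)[of "Suc i"] i by auto
    then have "T i \<inter> T (Suc i) \<in> K" by (intro face_K[OF _ cap])
    moreover have "\<gamma> (t (Suc i)) \<in> T i \<inter> T (Suc i)"
      using \<gamma>end(2)[of i] \<gamma>end(1)[of "Suc i"] i by auto
    moreover have "\<gamma> (t (Suc i)) \<in> \<gamma> ` {0..1}" using t01[of "Suc i"] i by auto
    ultimately show ?thesis
      using cross cut[OF i] unfolding crosses_only_hinge_def by blast
  qed
  have \<gamma>h: "\<gamma> (t (Suc i)) \<in> h" if i: "i < m" for i
    using capT[OF i] \<gamma>end(2)[of i] \<gamma>end(1)[of "Suc i"] i by auto
  have u: "unit_tangent \<gamma> 0 = sgn (w 0)"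
    by (rule unit_tangent_linear[OF _ _ _ \<gamma>[of 0]]) (use t[of 0] t0 t01[of "Suc 0"] in auto)
  have v: "unit_tangent \<gamma> 1 = sgn (w m)"
    by (rule unit_tangent_linear[OF _ _ _ \<gamma>[of m]]) (use t[of m] t1 t01[of m] in auto)
  \<comment> \<open>A segment that runs along the hinge is not excluded. It has constant velocity parallel to
    \<open>h\<close> and is covered by \<open>l = 0\<close>.\<close>
  show thesis
  proof (cases "w 0 \<in> directions h")
    case True
    \<comment> \<open>Each unfolding fixes \<open>w 0\<close> and is injective, so the velocity
      cannot change from piece to piece.\<close>
    have "w i = w 0" if "i \<le> m" for i
      using that
    proof (induction i)
      case (Suc i)
      then have i: "i < m" and wi: "w i = w 0" by auto
      obtain U where U: "rotation_matrix U" "U *v w 0 = w 0" "U *v w (Suc i) = w i"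
        using unf[OF i] True unfolding capT[OF i] unfolding_rotation_def by blast
      show ?case by (rule rotation_matrix_inj[OF U(1)]) (simp add: U wi)
    qed simp
    from this[of m] have wm: "w m = w 0" by simp
    obtain B where "{A, B} = {P, Q}" using A(1) by blast
    moreover have "sgn (w 0) \<in> directions h"
      unfolding sgn_div_norm using sD True by (rule subspace_scale)
    ultimately show thesis
      by (rule that[where l = 0]) (use u v w0[of 0] wm in \<open>simp_all add: norm_sgn\<close>)
  next
    case False
    have notboth: "\<not> (\<gamma> 0 \<in> h \<and> \<gamma> (t (Suc 0)) \<in> h)"
    proof
      assume "\<gamma> 0 \<in> h \<and> \<gamma> (t (Suc 0)) \<in> h"
      then have "w 0 \<in> directions h"
        using \<gamma>step[of 0] t[of 0] t0
        by (intro velocity_in_directions[of "\<gamma> 0" h "t (Suc 0)"]) auto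
      then show False using False by simp
    qed
    \<comment> \<open>With a single piece, the crossing point is interior to a segment in
      \<open>T 0\<close> and lies on the face \<open>T 0 \<inter> h\<close>; the face property then
      puts both end points on \<open>h\<close>.\<close>
    have "m \<noteq> 0"
    proof
      assume m: "m = 0"
      obtain s where s: "0 < s" "s < 1" "\<gamma> s \<in> h" using cross by (auto simp: crosses_only_hinge_def)
      have T0: "\<gamma> 0 \<in> T 0" "\<gamma> 1 \<in> T 0" "\<gamma> s \<in> T 0" using \<gamma>T[of 0] s t0 t1 m by auto
      have "\<gamma> 1 = \<gamma> 0 + w 0" "\<gamma> s = \<gamma> 0 + s *\<^sub>R w 0" using \<gamma>[of 0 1] \<gamma>[of 0 s] s t0 t1 m by auto
      then have "\<gamma> s \<in> open_segment (\<gamma> 0) (\<gamma> 1)"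
        using s w0[of 0] by (auto simp: in_segment algebra_simps intro!: exI[of _ s])
      moreover have "(T 0 \<inter> h) face_of T 0" using cap[OF T(1) hK] by simp
      ultimately have "\<gamma> 0 \<in> h" "\<gamma> 1 \<in> h" using face_ofD[of "T 0 \<inter> h" "T 0"] T0 s(3) by blast+
      then show False using notboth t1 m by simp
    qed
    then have h1: "\<gamma> (t (Suc 0)) \<in> h" using \<gamma>h by simp
    \<comment> \<open>A middle piece would have both ends on \<open>h\<close>, hence a velocity
      parallel to \<open>h\<close>; the unfolding fixes it, so \<open>w 0\<close> would be parallel
      to \<open>h\<close> too.\<close>
    have "m = 1"
    proof (rule ccontr)
      assume "m \<noteq> 1"
      then have m: "1 < m" using \<open>m \<noteq> 0\<close> by simp
      have "\<gamma> (t (Suc 1)) \<in> h" using \<gamma>h[OF m] .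
      then have w1: "w 1 \<in> directions h"
        using h1 \<gamma>step[of 1] t[of 1] m
        by (intro velocity_in_directions[of "\<gamma> (t 1)" h "t (Suc 1) - t 1"]) auto
      obtain U where "unfolding_rotation h (T 0) (T 1) U" "U *v w 1 = w 0"
        using unf[of 0] capT[of 0] m by auto
      then show False using w1 False by (auto simp: unfolding_rotation_def)
    qed
    have cap01: "T 0 \<inter> T 1 = h" using capT[of 0] \<open>m = 1\<close> by simp
    have TPQ: "T 0 \<in> {P, Q}" "T 1 \<in> {P, Q}"
      unfolding adj[symmetric] using T \<open>m = 1\<close> cap01 by auto
    \<comment> \<open>Equal simplices would intersect in an n-simplex, while \<open>h\<close> has
      dimension n - 1.\<close>
    have "T 0 \<noteq> T 1"
      using cap01 aff_dim_simplex[OF hs] aff_dim_simplex[OF T(2)[of 0]] by auto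
    have "A = T 0"
    proof (rule ccontr)
      assume "A \<noteq> T 0"
      then have "A = T 1" using A(1) TPQ \<open>T 0 \<noteq> T 1\<close> by auto
      then have "\<gamma> 0 \<in> h" using A(2) \<gamma>end(1)[of 0] t0 cap01 by auto
      then show False using notboth h1 by simp
    qed
    define B where "B = T 1"
    have AB: "{A, B} = {P, Q}" using TPQ \<open>T 0 \<noteq> T 1\<close> by (auto simp: \<open>A = T 0\<close> B_def)
    then have B: "B \<in> {P, Q}" by auto
    note cA = conormal_facet[OF hinge_facets(2)[OF K h A(1)] hs hinge_facets(3)[OF K h A(1)] hne]
    note cB = conormal_facet[OF hinge_facets(2)[OF K h B] hs hinge_facets(3)[OF K h B] hne]
    obtain U where U: "unfolding_rotation h A B U" "U *v w 1 = w 0"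
      using unf[of 0] \<open>m = 1\<close> cap01 by (auto simp: \<open>A = T 0\<close> B_def)
    have step: "\<gamma> 1 = \<gamma> (t 1) + (1 - t 1) *\<^sub>R w 1" and t1': "t 1 < 1"
      using \<gamma>step[of 1] t[of 1] t1 \<open>m = 1\<close> by auto
    have \<gamma>B: "\<gamma> (t 1) \<in> B" "\<gamma> 1 \<in> B" using \<gamma>end[of 1] t1 \<open>m = 1\<close> by (auto simp: B_def)
    then have w1B: "w 1 \<in> directions B"
      using step t1' by (intro velocity_in_directions[of "\<gamma> (t 1)" B "1 - t 1"]) auto
    \<comment> \<open>The last velocity is split along and across the hinge. Its conormal component
      is nonnegative because the piece starts on \<open>h\<close> and ends in
      \<open>B\<close>.\<close>
    define \<mu> d where "\<mu> = w 1 \<bullet> conormal h B" and "d = w 1 - \<mu> *\<^sub>R conormal h B"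
    have d: "d \<in> directions h" unfolding d_def \<mu>_def by (rule cB(5)[OF w1B])
    have w1: "w 1 = d + \<mu> *\<^sub>R conormal h B" by (simp add: d_def)
    have w0': "w 0 = d - \<mu> *\<^sub>R conormal h A"
      using U d unfolding unfolding_rotation_def w1
      by (auto simp: matrix_vector_right_distrib matrix_vector_mult_scaleR)
    have "0 \<le> conormal h B \<bullet> (\<gamma> 1 - \<gamma> (t 1))" using cB(4) \<gamma>B(2) h1 by simp
    then have \<mu>: "0 \<le> \<mu>"
      using t1' by (simp add: step \<mu>_def inner_commute zero_le_mult_iff)
    \<comment> \<open>Both pieces have the same speed, so normalising the tangents divides
      \<open>d\<close> and \<open>\<mu>\<close> by one common number.\<close>
    have "w 0 \<bullet> w 0 = d \<bullet> d + \<mu> * \<mu>" "w 1 \<bullet> w 1 = d \<bullet> d + \<mu> * \<mu>"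
      using cA(1) cB(1) cA(3)[OF d] cB(3)[OF d] unfolding w0' w1
      by (simp_all add: inner_add_left inner_add_right inner_diff_left inner_diff_right
          norm_eq_1 inner_commute)
    then have nw: "norm (w 1) = norm (w 0)" by (simp add: norm_eq)
    show thesis
    proof (rule that[OF AB])
      show "d /\<^sub>R norm (w 0) \<in> directions h" using sD d by (rule subspace_scale)
      show "0 \<le> \<mu> / norm (w 0)" using \<mu> by simp
      show "norm (unit_tangent \<gamma> 0) = 1" using w0[of 0] by (simp add: u norm_sgn)
      show "unit_tangent \<gamma> 0 = d /\<^sub>R norm (w 0) - (\<mu> / norm (w 0)) *\<^sub>R conormal h A"
        unfolding u sgn_div_norm
        by (subst (2) w0') (simp add: scaleR_diff_right divide_inverse mult.commute)
      show "unit_tangent \<gamma> 1 = d /\<^sub>R norm (w 0) + (\<mu> / norm (w 0)) *\<^sub>R conormal h B"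
        using v unfolding \<open>m = 1\<close> sgn_div_norm unfolding nw unfolding w1
        by (simp add: scaleR_add_right divide_inverse mult.commute)
    qed
  qed
qed

subsection \<open>The signed angle\<close>

text \<open>By the half-angle formula the argument of the arccosine is cos (2 \<beta>) with \<beta>
  = arcsin (l sin (e/2)), which gives only the modulus of 2 \<beta>. The case distinction restores
  the sign, since sin e and sin (e/2) both have the sign of \<open>e\<close> when its modulus is
  below pi.\<close>

lemma signed_arccos_eq:
  fixes l e :: real
  assumes l: "0 \<le> l" "l \<le> 1" and e: "\<bar>e\<bar> < pi"
  shows "(if 0 < l * sin e then arccos (1 - l\<^sup>2 * (1 - cos e)) else - arccos (1 - l\<^sup>2 * (1 - cos e)))
    = 2 * arcsin (l * sin (e/2))"
proof -
  define \<beta> where "\<beta> = arcsin (l * sin (e/2))"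
  have "\<bar>l * sin (e/2)\<bar> \<le> 1" using l by (simp add: abs_mult mult_le_one)
  then have b: "-1 \<le> l * sin (e/2)" "l * sin (e/2) \<le> 1" by auto
  have "cos (2 * \<beta>) = 1 - 2 * (l * sin (e/2))\<^sup>2"
    unfolding cos_double_sin \<beta>_def using b by simp
  also have "\<dots> = 1 - l\<^sup>2 * (1 - cos e)"
    using cos_double_sin[of "e/2"] by (simp add: power_mult_distrib)
  finally have cos: "1 - l\<^sup>2 * (1 - cos e) = cos (2 * \<beta>)" by simp
  have "\<bar>2 * \<beta>\<bar> \<le> pi" using arcsin_bounded[OF b] by (auto simp: \<beta>_def)
  then have ac: "arccos (1 - l\<^sup>2 * (1 - cos e)) = \<bar>2 * \<beta>\<bar>"
    unfolding cos by (rule arccos_cos_eq_abs)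
  show ?thesis
  proof (cases "0 < l * sin e")
    case True
    then have "0 < sin e" using l by (simp add: zero_less_mult_iff)
    then have "0 < e" using e sin_ge_zero[of "- e"] by (cases "e \<le> 0") auto
    then have "0 \<le> l * sin (e/2)" using l e by (simp add: sin_ge_zero)
    then have "0 \<le> \<beta>" unfolding \<beta>_def using b by (intro arcsin_nonneg) auto
    then show ?thesis using True ac by (simp add: \<beta>_def)
  next
    \<comment> \<open>This branch also contains l sin e = 0, where \<open>l\<close> or
      \<open>e\<close> vanishes and hence \<beta> = 0.\<close>
    case False
    then have "l = 0 \<or> e \<le> 0" using l e sin_gt_zero[of e] by (auto simp: not_less mult_le_0_iff)
    then have "l * sin (e/2) \<le> 0"
      using l e sin_ge_zero[of "- (e/2)"] by (auto simp: mult_le_0_iff)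
    then have "\<beta> \<le> 0" using arcsin_le_arcsin[of "l * sin (e/2)" 0] b by (simp add: \<beta>_def)
    then show ?thesis using False ac by (simp add: \<beta>_def)
  qed
qed

text \<open>The quadratic Taylor coefficient of sine vanishes, so the remainder after
  \<open>x\<close> is already cubic, with constant 1/3!.\<close>

lemma abs_sin_diff_le: "\<bar>sin x - x\<bar> \<le> \<bar>x\<bar> ^ 3 / 6" for x :: real
  using Maclaurin_sin_bound[of x 3]
  by (simp add: eval_nat_numeral sin_coeff_def field_simps)

text \<open>The cubic estimate for sine is used twice: at \<open>arcsin y\<close>, to replace the
  arcsine by its argument, and at \<open>e/2\<close>, to replace the sine by
  \<open>e/2\<close>.\<close>

lemma arcsin_scaled_sin_cubic:
  fixes l e :: real
  assumes l: "0 \<le> l" "l \<le> 1" and e: "\<bar>e\<bar> \<le> pi"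
  shows "\<bar>2 * arcsin (l * sin (e/2)) - l * e\<bar> \<le> \<bar>e\<bar> ^ 3"
proof -
  define y where "y = l * sin (e/2)"
  define z where "z = sin (\<bar>e\<bar>/2)"
  have z: "\<bar>sin (e/2)\<bar> = z" "0 \<le> z" "z \<le> 1"
    using e sin_ge_zero[of "\<bar>e\<bar>/2"] by (auto simp: z_def abs_if)
  have "\<bar>y\<bar> \<le> z" using l z by (simp add: y_def abs_mult mult_left_le_one_le)
  then have y: "- z \<le> y" "y \<le> z" by auto
  \<comment> \<open>The modulus of \<open>y\<close> is at most sin (|e|/2), and arcsine is monotone
    and inverts sine at |e|/2, which is at most pi/2.\<close>
  have "arcsin y \<le> arcsin z" "arcsin (- z) \<le> arcsin y"
    using y z(3) by (intro arcsin_le_arcsin; linarith)+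
  moreover have "arcsin z = \<bar>e\<bar>/2" unfolding z_def using e by (intro arcsin_sin) auto
  ultimately have a: "\<bar>arcsin y\<bar> \<le> \<bar>e\<bar>/2" using z by (simp add: arcsin_minus abs_le_iff)
  have "sin (arcsin y) = y" using y z(3) by (intro sin_arcsin) linarith+
  then have "\<bar>y - arcsin y\<bar> \<le> \<bar>arcsin y\<bar> ^ 3 / 6"
    using abs_sin_diff_le[of "arcsin y"] by simp
  also have "\<dots> \<le> (\<bar>e\<bar>/2) ^ 3 / 6" using a by (intro divide_right_mono power_mono) auto
  finally have 1: "\<bar>y - arcsin y\<bar> \<le> \<bar>e\<bar> ^ 3 / 48" by (simp add: power_divide)
  have "y - l * (e/2) = l * (sin (e/2) - e/2)" by (simp add: y_def right_diff_distrib)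
  then have "\<bar>y - l * (e/2)\<bar> = l * \<bar>sin (e/2) - e/2\<bar>" using l by (simp only: abs_mult)
  also have "\<dots> \<le> \<bar>sin (e/2) - e/2\<bar>" using l by (intro mult_left_le_one_le) auto
  also have "\<dots> \<le> \<bar>e\<bar> ^ 3 / 48" using abs_sin_diff_le[of "e/2"] by (simp add: power_divide)
  finally have 2: "\<bar>y - l * e / 2\<bar> \<le> \<bar>e\<bar> ^ 3 / 48" by simp
  \<comment> \<open>The two errors of 1/48 add up and are doubled, which gives the constant
    1/12.\<close>
  have "\<bar>2 * s - t\<bar> \<le> E / 12" if "\<bar>x - s\<bar> \<le> E / 48" "\<bar>x - t / 2\<bar> \<le> E / 48" for s t x E :: real
    using that by linarith
  from this[OF 1 2] have "\<bar>2 * arcsin y - l * e\<bar> \<le> \<bar>e\<bar> ^ 3 / 12" .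
  moreover have "0 \<le> \<bar>e\<bar> ^ 3" by simp
  ultimately show ?thesis unfolding y_def by linarith
qed

section \<open>The integrated curvature across one hinge\<close>

text \<open>As \<open>d\<close> is orthogonal to both conormals, the inner product of the tangents
  is |d|^2 + l^2 cos e with |d|^2 = 1 - l^2, and their difference l (a + b) has normal component l
  sin e. These are the data of \<open>signed_arccos_eq\<close>.\<close>

lemma integrated_curvature_crossing:
  fixes a b d \<nu> :: "'a::euclidean_space"
  assumes u: "unit_tangent \<gamma> 0 = d - l *\<^sub>R a" "norm (unit_tangent \<gamma> 0) = 1"
    and v: "unit_tangent \<gamma> 1 = d + l *\<^sub>R b"
    and norm: "norm a = 1" "norm b = 1"
    and d: "a \<bullet> d = 0" "b \<bullet> d = 0"
    and frame: "a \<bullet> b = - cos e" "a \<bullet> \<nu> = 0" "b \<bullet> \<nu> = sin e"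
    and l: "0 \<le> l" and e: "\<bar>e\<bar> < pi"
  shows "l \<le> 1" "vangle (unit_tangent \<gamma> 0) (- a) = arccos l"
    "integrated_curvature \<nu> \<gamma> = 2 * arcsin (l * sin (e/2))"
proof -
  have ip: "a \<bullet> a = 1" "b \<bullet> b = 1" "d \<bullet> a = 0" "d \<bullet> b = 0"
    using norm d by (auto simp: norm_eq_1 inner_commute)
  have dd: "d \<bullet> d + l\<^sup>2 = 1"
    using u(2) unfolding norm_eq_1 u(1)
    by (simp add: inner_diff_left inner_diff_right ip d power2_eq_square)
  have v1: "norm (unit_tangent \<gamma> 1) = 1"
    using dd unfolding norm_eq_1 v
    by (simp add: inner_add_left inner_add_right ip d power2_eq_square)
  have "l\<^sup>2 \<le> 1" using dd inner_ge_zero[of d] by linarith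
  then show l1: "l \<le> 1" using l by (simp add: power_le_one_iff)
  show "vangle (unit_tangent \<gamma> 0) (- a) = arccos l"
    unfolding vangle_def u(2) by (simp add: u(1) norm inner_diff_left ip)
  have uv: "unit_tangent \<gamma> 0 \<bullet> unit_tangent \<gamma> 1 = 1 - l\<^sup>2 * (1 - cos e)"
    using dd by (simp add: u(1) v inner_diff_left inner_add_right ip d frame power2_eq_square
        algebra_simps)
  have sign: "(unit_tangent \<gamma> 1 - unit_tangent \<gamma> 0) \<bullet> \<nu> = l * sin e"
    by (simp add: u(1) v inner_diff_left inner_add_left frame)
  show "integrated_curvature \<nu> \<gamma> = 2 * arcsin (l * sin (e/2))"
    unfolding integrated_curvature_def Let_def vangle_def u(2) v1 uv sign mult_1 div_by_1
    by (rule signed_arccos_eq[OF l l1 e])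
qed

text \<open>The hinge angle is measured from \<open>P\<close>, but the segment may start on either
  side. Exchanging the two simplices leaves these inner products unchanged, so one hinge angle
  serves both cases.\<close>

lemma hinge_frame_symmetric:
  fixes P Q h :: "(real^'m) set"
  assumes card: "CARD('m) = n + 1" and n: "n \<ge> 1"
    and K: "loc_simplicial_complex K" and h: "hinge n K h P Q" and N: "positive_normals h P Q N"
    and AB: "{A, B} = {P, Q}"
  shows "conormal h A \<bullet> conormal h B = - cos (hinge_angle h P Q N)"
    and "conormal h A \<bullet> N A = 0"
    and "conormal h B \<bullet> N A = sin (hinge_angle h P Q N)"
proof -
  have hs: "(int n - 1) simplex h" and PQ: "P \<noteq> Q" using h by (auto simp: hinge_def)
  have hne: "h \<noteq> {}" using hs n by auto
  note P = hinge_facets[OF K h, of P, simplified] and Q = hinge_facets[OF K h, of Q, simplified]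
  note cP = conormal_facet[OF P(2) hs P(3) hne]
  note frame = hinge_frame[OF card P(2) Q(2) hs P(3) Q(3) hne N]
  have "unit_normal P (N P)" using N by (simp add: positive_normals_def)
  then have ip: "conormal h P \<bullet> conormal h P = 1" "N P \<bullet> N P = 1"
    "conormal h P \<bullet> N P = 0" "N P \<bullet> conormal h P = 0"
    using cP(1,2) by (auto simp: unit_normal_def norm_eq_1 inner_commute)
  consider "A = P" "B = Q" | "A = Q" "B = P" using AB PQ by (auto simp: doubleton_eq_iff)
  then show "conormal h A \<bullet> conormal h B = - cos (hinge_angle h P Q N)"
    "conormal h A \<bullet> N A = 0"
    "conormal h B \<bullet> N A = sin (hinge_angle h P Q N)"
    by (cases; simp add: frame inner_add_right inner_diff_left inner_diff_right ip)+
qed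

text \<open>Binding \<open>C\<close> and \<open>\<delta>\<close> before the complex makes the error
  term uniform over all hypersurfaces, hinges and segments of the given dimension. The unoriented
  angle determines \<open>\<theta>\<close> up to sign, hence the modulus.\<close>

theorem theorem5:
  fixes n :: nat
  assumes "CARD('m::finite) = n + 1" and "n \<ge> 1"
  shows "\<exists>C>0. \<exists>\<delta>>0.
    \<forall>(K :: (real^'m) set set) h P Q A N \<gamma> \<theta>.
      piecewise_flat_submanifold n K \<and> hinge n K h P Q \<and> positive_normals h P Q N \<and>
      geodesic_segment n K \<gamma> \<and> crosses_only_hinge n K \<gamma> h \<and>
      A \<in> {P, Q} \<and> \<gamma> 0 \<in> A \<and>
      \<bar>\<theta>\<bar> = vangle (unit_tangent \<gamma> 0) (- conormal h A) \<and>
      \<bar>hinge_angle h P Q N\<bar> < \<delta>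
      \<longrightarrow>
      \<bar>integrated_curvature (N A) \<gamma> - cos \<theta> * hinge_angle h P Q N\<bar>
        \<le> C * \<bar>hinge_angle h P Q N\<bar> ^ 3 \<and>
      (\<theta> \<in> {0, pi/2, - (pi/2)} \<longrightarrow>
        integrated_curvature (N A) \<gamma> = cos \<theta> * hinge_angle h P Q N)"
\<comment> \<open>The witness 1 for \<open>C\<close> comes from the cubic bound, and pi for
  \<open>\<delta>\<close> from the range in which the closed form of the signed angle is
  proved.\<close>
proof (rule exI[of _ 1], rule conjI[OF zero_less_one], rule exI[of _ pi],
    rule conjI[OF pi_gt_zero], intro allI impI, elim conjE)
  fix K :: "(real^'m) set set" and h P Q A :: "(real^'m) set" and N \<gamma> \<theta>
  define e where "e = hinge_angle h P Q N"
  assume "piecewise_flat_submanifold n K" and h: "hinge n K h P Q" and N: "positive_normals h P Q N"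
    and geo: "geodesic_segment n K \<gamma>" "crosses_only_hinge n K \<gamma> h"
    and A: "A \<in> {P, Q}" "\<gamma> 0 \<in> A"
    and \<theta>: "\<bar>\<theta>\<bar> = vangle (unit_tangent \<gamma> 0) (- conormal h A)"
    and "\<bar>hinge_angle h P Q N\<bar> < pi"
  then have K: "loc_simplicial_complex K" and e: "\<bar>e\<bar> < pi"
    by (auto simp: piecewise_flat_submanifold_def e_def)
  have hs: "(int n - 1) simplex h" using h by (auto simp: hinge_def)
  have hne: "h \<noteq> {}" using hs assms(2) by auto
  obtain B d l where AB: "{A, B} = {P, Q}" and d: "d \<in> directions h" and l: "0 \<le> l"
    and uv: "norm (unit_tangent \<gamma> 0) = 1" "unit_tangent \<gamma> 0 = d - l *\<^sub>R conormal h A"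
      "unit_tangent \<gamma> 1 = d + l *\<^sub>R conormal h B"
    using geodesic_tangents[OF assms(2) K h geo A] by blast
  have B: "B \<in> {P, Q}" using AB by blast
  note cA = conormal_facet[OF hinge_facets(2)[OF K h A(1)] hs hinge_facets(3)[OF K h A(1)] hne]
  note cB = conormal_facet[OF hinge_facets(2)[OF K h B] hs hinge_facets(3)[OF K h B] hne]
  note frame = hinge_frame_symmetric[OF assms K h N AB, folded e_def]
  note crossing = integrated_curvature_crossing[OF uv(2,1,3) cA(1) cB(1) cA(3)[OF d] cB(3)[OF d]
      frame l e]
  \<comment> \<open>Cosine is even, so the sign of \<open>\<theta>\<close> has no effect.\<close>
  have "cos \<theta> = cos (arccos l)" using \<theta> crossing(2) by (metis cos_abs_real)
  then have cos: "cos \<theta> = l" using l crossing(1) by simp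
  show "\<bar>integrated_curvature (N A) \<gamma> - cos \<theta> * hinge_angle h P Q N\<bar>
      \<le> 1 * \<bar>hinge_angle h P Q N\<bar> ^ 3 \<and>
      (\<theta> \<in> {0, pi/2, - (pi/2)} \<longrightarrow>
        integrated_curvature (N A) \<gamma> = cos \<theta> * hinge_angle h P Q N)"
    unfolding e_def[symmetric]
  proof (intro conjI impI)
    show "\<bar>integrated_curvature (N A) \<gamma> - cos \<theta> * e\<bar> \<le> 1 * \<bar>e\<bar> ^ 3"
      using arcsin_scaled_sin_cubic[OF l crossing(1), of e] e by (simp add: crossing(3) cos)
    assume "\<theta> \<in> {0, pi/2, - (pi/2)}"
    \<comment> \<open>The exceptional angles are l = 1 and l = 0, for which 2 arcsin (l sin (e/2))
      equals \<open>e\<close> and 0 exactly.\<close>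
    then have "l = 1 \<or> l = 0"
      unfolding cos[symmetric]
      by (auto simp only: cos_zero cos_pi_half cos_minus insert_iff empty_iff)
    moreover have "arcsin (sin (e/2)) = e/2" using e by (intro arcsin_sin) auto
    ultimately show "integrated_curvature (N A) \<gamma> = cos \<theta> * e"
      by (auto simp: crossing(3) cos)
  qed
qed

end
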